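(* The set function $$f(S)=\sum_{k=1}^K p_{k0}\Bigl(1-\prod_{n:(n,k)\in S}(1-\alpha_{nk})\Bigr),\qquad S\subseteq\mathcal{E},$$ is increasing (i.e. $f(S')\le f(S)$ whenever $S'\subseteq S$) and submodular in $S$.
   Context: There are $N$ agents, each with a budget of exactly one search, and $K$ locations. (This arises from a problem with $M$ agents with budgets $N_m$, $N=\sum_m N_m$, by splitting each agent into unit-budget agents with unique identities.) $\mathcal{E}\subseteq\{1,\dots,N\}\times\{1,\dots,K\}$ is the set of accessibility pairs: $(n,k)\in\mathcal{E}$ iff agent $n$ can search location $k$. $p_{k0}\in[0,1]$ is the prior probability that the hidden object is in location $k$, and $\alpha_{nk}\in[0,1]$, for $(n,k)\in\mathcal{E}$, is the probability that a search of location $k$ by agent $n$ finds the object if it is there. An empty product equals $1$. Submodular means the diminishing-returns property: for $S'\subseteq S\subseteq\mathcal{E}$ and $e\in\mathcal{E}\setminus S$, $f(S'\cup\{e\})-f(S')\ge f(S\cup\{e\})-f(S)$. *)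

theory Defs
  imports Complex_Main
begin

text \<open>
  Priors \<open>p k\<close> (the paper's \<open>p_{k0}\<close>) and detection probabilities \<open>\<alpha> n k\<close>; a plan
  \<open>S\<close> is a set of pairs \<open>(n, k)\<close>, meaning that agent \<open>n\<close> searches location \<open>k\<close>.
  The index set of the product is finite for every finite \<open>S\<close>; for infinite index sets
  the library's product would silently be 1.
\<close>

definition detection_prob ::
  "nat \<Rightarrow> (nat \<Rightarrow> real) \<Rightarrow> (nat \<Rightarrow> nat \<Rightarrow> real) \<Rightarrow> (nat \<times> nat) set \<Rightarrow> real" where
  "detection_prob K p \<alpha> S =
     (\<Sum>k = 1..K. p k * (1 - (\<Prod>n \<in> {n. (n, k) \<in> S}. 1 - \<alpha> n k)))"

definition submodular_on :: "'a set \<Rightarrow> ('a set \<Rightarrow> real) \<Rightarrow> bool" where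
  "submodular_on E f \<longleftrightarrow>
     (\<forall>S' S e. S' \<subseteq> S \<and> S \<subseteq> E \<and> e \<in> E - S \<longrightarrow>
        f (S' \<union> {e}) - f S' \<ge> f (S \<union> {e}) - f S)"

end

theory Submission
  imports Defs
begin

text \<open>
  If the object is in location \<open>k\<close> and searches are independent, the plan \<open>S\<close> misses it with
  probability \<open>miss_prob \<alpha> S k\<close>, a product of factors in \<open>[0,1]\<close>. Enlarging \<open>S\<close> only multiplies in
  further such factors, so it lowers every miss probability and \<open>detection_prob\<close> increases.
  For submodularity, adding a new search \<open>(m, j)\<close> to \<open>S\<close> affects location \<open>j\<close> alone, where it
  multiplies the miss probability by \<open>1 - \<alpha> m j\<close>. The gain is therefore exactly
  \<open>p j * \<alpha> m j * miss_prob \<alpha> S j\<close>: the new search pays off only when the object is in \<open>j\<close>,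
  this search finds it, and all searches in \<open>S\<close> miss it. In this formula \<open>S\<close> enters only through
  its miss probability, so diminishing returns is the same monotonicity fact once more.
\<close>

definition miss_prob :: "(nat \<Rightarrow> nat \<Rightarrow> real) \<Rightarrow> (nat \<times> nat) set \<Rightarrow> nat \<Rightarrow> real" where
  "miss_prob \<alpha> S k = (\<Prod>n \<in> {n. (n, k) \<in> S}. 1 - \<alpha> n k)"

lemma detection_prob_miss_prob:
  "detection_prob K p \<alpha> S = (\<Sum>k = 1..K. p k * (1 - miss_prob \<alpha> S k))"
  by (simp add: detection_prob_def miss_prob_def)

lemma finite_searchers: "finite S \<Longrightarrow> finite {n. (n, k) \<in> S}"
  by (rule finite_subset[of _ "fst ` S"]) force+

text \<open>
  The extra searches of \<open>S\<close> contribute a factor in \<open>[0,1]\<close>. Finiteness matters: a product over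
  an infinite index set is \<open>1\<close> by convention, so an infinite plan could appear to miss more
  often than a finite part of it.
\<close>

lemma miss_prob_antimono:
  assumes "finite S" and "S' \<subseteq> S" and "\<And>n. (n, k) \<in> S \<Longrightarrow> \<alpha> n k \<in> {0..1}"
  shows "miss_prob \<alpha> S k \<le> miss_prob \<alpha> S' k"
proof -
  let ?A = "{n. (n, k) \<in> S}" and ?B = "{n. (n, k) \<in> S'}"
  have "?B \<subseteq> ?A"
    using assms(2) by auto
  then have split: "miss_prob \<alpha> S k = (\<Prod>n \<in> ?A - ?B. 1 - \<alpha> n k) * miss_prob \<alpha> S' k"
    unfolding miss_prob_def by (intro prod.subset_diff finite_searchers assms(1))
  have "(\<Prod>n \<in> ?A - ?B. 1 - \<alpha> n k) \<le> 1"
    using assms(3) by (intro prod_le_1) auto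
  moreover have "0 \<le> miss_prob \<alpha> S' k"
    unfolding miss_prob_def using assms(2,3) by (intro prod_nonneg) auto
  ultimately show ?thesis
    unfolding split by (intro mult_left_le_one_le prod_nonneg) (use assms(3) in auto)
qed

lemma miss_prob_insert:
  assumes "finite S" and "(m, j) \<notin> S"
  shows "miss_prob \<alpha> (insert (m, j) S) k =
    (if k = j then (1 - \<alpha> m j) * miss_prob \<alpha> S j else miss_prob \<alpha> S k)"
proof -
  have "{n. (n, k) \<in> insert (m, j) S} =
      (if k = j then insert m {n. (n, j) \<in> S} else {n. (n, k) \<in> S})"
    by auto
  then show ?thesis
    using assms by (simp add: miss_prob_def finite_searchers)
qed

text \<open>
  All summands other than the one for \<open>j\<close> cancel, and there
  \<open>(1 - (1 - \<alpha> m j) * q) - (1 - q) = \<alpha> m j * q\<close> with \<open>q = miss_prob \<alpha> S j\<close>.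
\<close>

lemma detection_prob_gain:
  assumes "finite S" and "(m, j) \<notin> S" and "j \<in> {1..K}"
  shows "detection_prob K p \<alpha> (insert (m, j) S) - detection_prob K p \<alpha> S =
    p j * \<alpha> m j * miss_prob \<alpha> S j"
proof -
  have "detection_prob K p \<alpha> (insert (m, j) S) - detection_prob K p \<alpha> S =
      (\<Sum>k = 1..K. if k = j then p j * \<alpha> m j * miss_prob \<alpha> S j else 0)"
    unfolding detection_prob_miss_prob sum_subtractf[symmetric]
    by (intro sum.cong) (auto simp: miss_prob_insert[OF assms(1,2)] algebra_simps)
  then show ?thesis
    using assms(3) by simp
qed

theorem lemmaV1:
  fixes N K :: nat
    and E :: "(nat \<times> nat) set"
    and p :: "nat \<Rightarrow> real"
    and \<alpha> :: "nat \<Rightarrow> nat \<Rightarrow> real"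
  assumes "E \<subseteq> {1..N} \<times> {1..K}"
    and "\<And>k. k \<in> {1..K} \<Longrightarrow> p k \<in> {0..1}"
    and "\<And>n k. (n, k) \<in> E \<Longrightarrow> \<alpha> n k \<in> {0..1}"
  shows "mono_on (Pow E) (detection_prob K p \<alpha>) \<and> submodular_on E (detection_prob K p \<alpha>)"
proof
  have fin: "finite S" if "S \<subseteq> E" for S
    using that assms(1) by (meson finite_SigmaI finite_atLeastAtMost finite_subset)
  have miss: "miss_prob \<alpha> S k \<le> miss_prob \<alpha> S' k" if "S' \<subseteq> S" "S \<subseteq> E" for S S' k
    using that assms(3) by (intro miss_prob_antimono fin) auto
  show "mono_on (Pow E) (detection_prob K p \<alpha>)"
  proof (rule mono_onI)
    fix S' S assume "S \<in> Pow E" "S' \<subseteq> S"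
    then show "detection_prob K p \<alpha> S' \<le> detection_prob K p \<alpha> S"
      unfolding detection_prob_miss_prob using assms(2) miss
      by (intro sum_mono mult_left_mono) auto
  qed
  show "submodular_on E (detection_prob K p \<alpha>)"
    unfolding submodular_on_def
  proof (intro allI impI)
    fix S' S e assume *: "S' \<subseteq> S \<and> S \<subseteq> E \<and> e \<in> E - S"
    obtain m j where e: "e = (m, j)"
      by (cases e)
    have j: "j \<in> {1..K}"
      using * e assms(1) by auto
    have "p j * \<alpha> m j * miss_prob \<alpha> S j \<le> p j * \<alpha> m j * miss_prob \<alpha> S' j"
      using * e assms(2)[OF j] assms(3)[of m j] by (intro mult_left_mono miss) auto
    moreover have "finite S" "finite S'" "(m, j) \<notin> S" "(m, j) \<notin> S'"
      using * e fin by auto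
    ultimately show "detection_prob K p \<alpha> (S' \<union> {e}) - detection_prob K p \<alpha> S'
        \<ge> detection_prob K p \<alpha> (S \<union> {e}) - detection_prob K p \<alpha> S"
      using detection_prob_gain[OF _ _ j] by (simp add: e)
  qed
qed

end
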